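(* Let $k$ be a field of positive characteristic $p>0$ and let $\varphi: A_1(k)\rightarrow A_1(k)$ be the $k$-algebra endomorphism of the first Weyl algebra given by $$\varphi(x)=x,\qquad \varphi(\partial)=\partial+x^{p-1}\partial^p.$$ Then $\varphi$ is not a flat ring homomorphism.
   Context: The first Weyl algebra $A_1(k)$ is the $k$-algebra generated freely by $x,\partial$ subject to the relation $\partial x-x\partial=1$. A ring homomorphism $\varphi: S\rightarrow T$ makes $T$ a left $S$-module via $s.t=\varphi(s)t$ and a right $S$-module via $t.s=t\varphi(s)$. It is called left flat if $M\mapsto M\otimes_S T$ is an exact functor from right $S$-modules to right $T$-modules, right flat if $M\mapsto T\otimes_S M$ is an exact functor from left $S$-modules to left $T$-modules, and flat if it is both left and right flat. *)

theory Defs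
  imports "HOL-Algebra.Algebra" "HOL-Algebra.Algebraic_Closure_Type" "HOL-Library.Poly_Mapping"
begin

section \<open>One-sided modules over a ring\<close>

text \<open>
  The locale \<^locale>\<open>module\<close> requires a commutative ring of scalars, so one-sided modules are
  introduced here, on the same record type; its fields for a multiplication and a one on the
  module are never used. For a right module, \<open>a \<odot> x\<close> denotes the product \<open>x . a\<close>.
\<close>

locale left_module = R: ring R + M: abelian_group M
  for R :: "('a, 'r) ring_scheme" (structure) and M :: "('a, 'm) module" (structure) +
  assumes lsmult_closed:
      "\<lbrakk>a \<in> carrier R; x \<in> carrier M\<rbrakk> \<Longrightarrow> a \<odot>\<^bsub>M\<^esub> x \<in> carrier M"
    and lsmult_l_distr:
      "\<lbrakk>a \<in> carrier R; b \<in> carrier R; x \<in> carrier M\<rbrakk>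
        \<Longrightarrow> (a \<oplus>\<^bsub>R\<^esub> b) \<odot>\<^bsub>M\<^esub> x = a \<odot>\<^bsub>M\<^esub> x \<oplus>\<^bsub>M\<^esub> b \<odot>\<^bsub>M\<^esub> x"
    and lsmult_r_distr:
      "\<lbrakk>a \<in> carrier R; x \<in> carrier M; y \<in> carrier M\<rbrakk>
        \<Longrightarrow> a \<odot>\<^bsub>M\<^esub> (x \<oplus>\<^bsub>M\<^esub> y) = a \<odot>\<^bsub>M\<^esub> x \<oplus>\<^bsub>M\<^esub> a \<odot>\<^bsub>M\<^esub> y"
    and lsmult_assoc:
      "\<lbrakk>a \<in> carrier R; b \<in> carrier R; x \<in> carrier M\<rbrakk>
        \<Longrightarrow> (a \<otimes>\<^bsub>R\<^esub> b) \<odot>\<^bsub>M\<^esub> x = a \<odot>\<^bsub>M\<^esub> (b \<odot>\<^bsub>M\<^esub> x)"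
    and lsmult_one:
      "x \<in> carrier M \<Longrightarrow> \<one>\<^bsub>R\<^esub> \<odot>\<^bsub>M\<^esub> x = x"

locale right_module = R: ring R + M: abelian_group M
  for R :: "('a, 'r) ring_scheme" (structure) and M :: "('a, 'm) module" (structure) +
  assumes rsmult_closed:
      "\<lbrakk>a \<in> carrier R; x \<in> carrier M\<rbrakk> \<Longrightarrow> a \<odot>\<^bsub>M\<^esub> x \<in> carrier M"
    and rsmult_l_distr:
      "\<lbrakk>a \<in> carrier R; b \<in> carrier R; x \<in> carrier M\<rbrakk>
        \<Longrightarrow> (a \<oplus>\<^bsub>R\<^esub> b) \<odot>\<^bsub>M\<^esub> x = a \<odot>\<^bsub>M\<^esub> x \<oplus>\<^bsub>M\<^esub> b \<odot>\<^bsub>M\<^esub> x"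
    and rsmult_r_distr:
      "\<lbrakk>a \<in> carrier R; x \<in> carrier M; y \<in> carrier M\<rbrakk>
        \<Longrightarrow> a \<odot>\<^bsub>M\<^esub> (x \<oplus>\<^bsub>M\<^esub> y) = a \<odot>\<^bsub>M\<^esub> x \<oplus>\<^bsub>M\<^esub> a \<odot>\<^bsub>M\<^esub> y"
    and rsmult_assoc:
      "\<lbrakk>a \<in> carrier R; b \<in> carrier R; x \<in> carrier M\<rbrakk>
        \<Longrightarrow> (a \<otimes>\<^bsub>R\<^esub> b) \<odot>\<^bsub>M\<^esub> x = b \<odot>\<^bsub>M\<^esub> (a \<odot>\<^bsub>M\<^esub> x)"
    and rsmult_one:
      "x \<in> carrier M \<Longrightarrow> \<one>\<^bsub>R\<^esub> \<odot>\<^bsub>M\<^esub> x = x"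

definition module_homs ::
    "('a, 'r) ring_scheme \<Rightarrow> ('a, 'm) module \<Rightarrow> ('a, 'n) module \<Rightarrow> ('m \<Rightarrow> 'n) set" where
  "module_homs R M N =
    {f \<in> carrier M \<rightarrow> carrier N.
       (\<forall>x\<in>carrier M. \<forall>y\<in>carrier M. f (x \<oplus>\<^bsub>M\<^esub> y) = f x \<oplus>\<^bsub>N\<^esub> f y) \<and>
       (\<forall>a\<in>carrier R. \<forall>x\<in>carrier M. f (a \<odot>\<^bsub>M\<^esub> x) = a \<odot>\<^bsub>N\<^esub> f x)}"

definition short_exact ::
    "('a, 'l) module \<Rightarrow> ('a, 'm) module \<Rightarrow> ('a, 'n) module \<Rightarrow> ('l \<Rightarrow> 'm) \<Rightarrow> ('m \<Rightarrow> 'n) \<Rightarrow> bool" where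
  "short_exact L M N f g \<longleftrightarrow>
     inj_on f (carrier L) \<and> f ` carrier L = a_kernel M N g \<and> g ` carrier M = carrier N"


section \<open>Tensor products over a noncommutative ring\<close>

text \<open>
  For a right \<open>R\<close>-module \<open>N\<close> and a left \<open>R\<close>-module \<open>M\<close>, the tensor product is the free abelian
  group on the pairs \<open>(n, m)\<close> modulo the subgroup generated by the biadditivity and balancing
  relators.
\<close>

definition tensor_relators ::
    "('a, 'r) ring_scheme \<Rightarrow> ('a, 'n) module \<Rightarrow> ('a, 'm) module \<Rightarrow> ('n \<times> 'm \<Rightarrow>\<^sub>0 int) set" where
  "tensor_relators R N M =
     {frag_of (n \<oplus>\<^bsub>N\<^esub> n', m) - frag_of (n, m) - frag_of (n', m) | n n' m.
        n \<in> carrier N \<and> n' \<in> carrier N \<and> m \<in> carrier M} \<union>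
     {frag_of (n, m \<oplus>\<^bsub>M\<^esub> m') - frag_of (n, m) - frag_of (n, m') | n m m'.
        n \<in> carrier N \<and> m \<in> carrier M \<and> m' \<in> carrier M} \<union>
     {frag_of (a \<odot>\<^bsub>N\<^esub> n, m) - frag_of (n, a \<odot>\<^bsub>M\<^esub> m) | a n m.
        a \<in> carrier R \<and> n \<in> carrier N \<and> m \<in> carrier M}"

definition tensor_null ::
    "('a, 'r) ring_scheme \<Rightarrow> ('a, 'n) module \<Rightarrow> ('a, 'm) module \<Rightarrow> ('n \<times> 'm \<Rightarrow>\<^sub>0 int) set" where
  "tensor_null R N M =
     generate (free_Abelian_group (carrier N \<times> carrier M)) (tensor_relators R N M)"

definition tensor_group ::
    "('a, 'r) ring_scheme \<Rightarrow> ('a, 'n) module \<Rightarrow> ('a, 'm) module \<Rightarrow> ('n \<times> 'm \<Rightarrow>\<^sub>0 int) set monoid" where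
  "tensor_group R N M = free_Abelian_group (carrier N \<times> carrier M) Mod tensor_null R N M"

text \<open>
  The map into the tensor product of \<open>N\<close> and \<open>M\<close> induced by a map \<open>h\<close> on pairs, sending the class
  of \<open>\<Sum> c\<^sub>i (n\<^sub>i, m\<^sub>i)\<close> to the class of \<open>\<Sum> c\<^sub>i h (n\<^sub>i, m\<^sub>i)\<close>. It is only applied where the latter
  class does not depend on the representative, so that the union is over equal cosets.
\<close>

definition tensor_map ::
    "('a, 'r) ring_scheme \<Rightarrow> ('a, 'n) module \<Rightarrow> ('a, 'm) module \<Rightarrow> ('k \<times> 'l \<Rightarrow> 'n \<times> 'm)
       \<Rightarrow> ('k \<times> 'l \<Rightarrow>\<^sub>0 int) set \<Rightarrow> ('n \<times> 'm \<Rightarrow>\<^sub>0 int) set" where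
  "tensor_map R N M h C =
     (\<Union>c\<in>C. tensor_null R N M
        #>\<^bsub>free_Abelian_group (carrier N \<times> carrier M)\<^esub> frag_extend (frag_of \<circ> h) c)"

text \<open>The tensor product, with scalars \<open>t\<close> acting through the maps \<open>act t\<close> on pairs.\<close>

definition tensor_module ::
    "('a, 'r) ring_scheme \<Rightarrow> ('a, 'n) module \<Rightarrow> ('a, 'm) module \<Rightarrow> ('t \<Rightarrow> 'n \<times> 'm \<Rightarrow> 'n \<times> 'm)
       \<Rightarrow> ('t, ('n \<times> 'm \<Rightarrow>\<^sub>0 int) set) module" where
  "tensor_module R N M act =
     \<lparr>carrier = carrier (tensor_group R N M), monoid.mult = undefined, one = undefined,
      ring.zero = \<one>\<^bsub>tensor_group R N M\<^esub>, add = monoid.mult (tensor_group R N M),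
      module.smult = (\<lambda>t. tensor_map R N M (act t))\<rparr>"


section \<open>Flat ring homomorphisms\<close>

definition left_via :: "('b, 't) ring_scheme \<Rightarrow> ('a \<Rightarrow> 'b) \<Rightarrow> ('a, 'b) module" where
  "left_via T \<phi> =
     \<lparr>carrier = carrier T, monoid.mult = monoid.mult T, one = \<one>\<^bsub>T\<^esub>, ring.zero = \<zero>\<^bsub>T\<^esub>, add = add T,
      module.smult = (\<lambda>s t. \<phi> s \<otimes>\<^bsub>T\<^esub> t)\<rparr>"

definition right_via :: "('b, 't) ring_scheme \<Rightarrow> ('a \<Rightarrow> 'b) \<Rightarrow> ('a, 'b) module" where
  "right_via T \<phi> =
     \<lparr>carrier = carrier T, monoid.mult = monoid.mult T, one = \<one>\<^bsub>T\<^esub>, ring.zero = \<zero>\<^bsub>T\<^esub>, add = add T,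
      module.smult = (\<lambda>s t. t \<otimes>\<^bsub>T\<^esub> \<phi> s)\<rparr>"

text \<open>The functor from right \<open>S\<close>-modules \<open>M\<close> to right \<open>T\<close>-modules \<open>M \<otimes>\<^sub>S T\<close>.\<close>

definition tensor_right ::
    "('a, 's) ring_scheme \<Rightarrow> ('b, 't) ring_scheme \<Rightarrow> ('a \<Rightarrow> 'b) \<Rightarrow> ('a, 'm) module
       \<Rightarrow> ('b, ('m \<times> 'b \<Rightarrow>\<^sub>0 int) set) module" where
  "tensor_right S T \<phi> M = tensor_module S M (left_via T \<phi>) (\<lambda>t (m, t'). (m, t' \<otimes>\<^bsub>T\<^esub> t))"

definition tensor_right_map ::
    "('a, 's) ring_scheme \<Rightarrow> ('b, 't) ring_scheme \<Rightarrow> ('a \<Rightarrow> 'b) \<Rightarrow> ('a, 'n) module \<Rightarrow> ('m \<Rightarrow> 'n)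
       \<Rightarrow> ('m \<times> 'b \<Rightarrow>\<^sub>0 int) set \<Rightarrow> ('n \<times> 'b \<Rightarrow>\<^sub>0 int) set" where
  "tensor_right_map S T \<phi> N f = tensor_map S N (left_via T \<phi>) (\<lambda>(m, t). (f m, t))"

text \<open>The functor from left \<open>S\<close>-modules \<open>M\<close> to left \<open>T\<close>-modules \<open>T \<otimes>\<^sub>S M\<close>.\<close>

definition tensor_left ::
    "('a, 's) ring_scheme \<Rightarrow> ('b, 't) ring_scheme \<Rightarrow> ('a \<Rightarrow> 'b) \<Rightarrow> ('a, 'm) module
       \<Rightarrow> ('b, ('b \<times> 'm \<Rightarrow>\<^sub>0 int) set) module" where
  "tensor_left S T \<phi> M = tensor_module S (right_via T \<phi>) M (\<lambda>t (t', m). (t \<otimes>\<^bsub>T\<^esub> t', m))"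

definition tensor_left_map ::
    "('a, 's) ring_scheme \<Rightarrow> ('b, 't) ring_scheme \<Rightarrow> ('a \<Rightarrow> 'b) \<Rightarrow> ('a, 'n) module \<Rightarrow> ('m \<Rightarrow> 'n)
       \<Rightarrow> ('b \<times> 'm \<Rightarrow>\<^sub>0 int) set \<Rightarrow> ('b \<times> 'n \<Rightarrow>\<^sub>0 int) set" where
  "tensor_left_map S T \<phi> N f = tensor_map S (right_via T \<phi>) N (\<lambda>(t, m). (t, f m))"

text \<open>
  HOL cannot quantify over types inside a formula, so the modules range over those whose carrier
  lies in a type \<open>'m\<close>, given as an argument. Flatness depends only on finitely generated modules
  (indeed on ideals), so it is the usual notion as soon as \<open>'m\<close> has at least the cardinality of
  an infinite \<open>S\<close>; and for any \<open>'m\<close>, its failure here implies its failure in the usual sense.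
  The induced maps are automatically \<open>T\<close>-linear, so the exactness of the
  image sequence is a condition on the underlying maps alone.
\<close>

definition left_flat ::
    "'m itself \<Rightarrow> ('a, 's) ring_scheme \<Rightarrow> ('b, 't) ring_scheme \<Rightarrow> ('a \<Rightarrow> 'b) \<Rightarrow> bool" where
  "left_flat _ S T \<phi> \<longleftrightarrow>
     (\<forall>(L :: ('a, 'm) module) (M :: ('a, 'm) module) (N :: ('a, 'm) module) f g.
        right_module S L \<and> right_module S M \<and> right_module S N \<and>
        f \<in> module_homs S L M \<and> g \<in> module_homs S M N \<and> short_exact L M N f g \<longrightarrow>
        short_exact (tensor_right S T \<phi> L) (tensor_right S T \<phi> M) (tensor_right S T \<phi> N)
          (tensor_right_map S T \<phi> M f) (tensor_right_map S T \<phi> N g))"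

definition right_flat ::
    "'m itself \<Rightarrow> ('a, 's) ring_scheme \<Rightarrow> ('b, 't) ring_scheme \<Rightarrow> ('a \<Rightarrow> 'b) \<Rightarrow> bool" where
  "right_flat _ S T \<phi> \<longleftrightarrow>
     (\<forall>(L :: ('a, 'm) module) (M :: ('a, 'm) module) (N :: ('a, 'm) module) f g.
        left_module S L \<and> left_module S M \<and> left_module S N \<and>
        f \<in> module_homs S L M \<and> g \<in> module_homs S M N \<and> short_exact L M N f g \<longrightarrow>
        short_exact (tensor_left S T \<phi> L) (tensor_left S T \<phi> M) (tensor_left S T \<phi> N)
          (tensor_left_map S T \<phi> M f) (tensor_left_map S T \<phi> N g))"

definition flat_hom ::
    "'m itself \<Rightarrow> ('a, 's) ring_scheme \<Rightarrow> ('b, 't) ring_scheme \<Rightarrow> ('a \<Rightarrow> 'b) \<Rightarrow> bool" where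
  "flat_hom m S T \<phi> \<longleftrightarrow> left_flat m S T \<phi> \<and> right_flat m S T \<phi>"


section \<open>The first Weyl algebra\<close>

datatype 'a free_monoid = Word (letters: "'a list")

instantiation free_monoid :: (type) monoid_add
begin

definition zero_free_monoid :: "'a free_monoid" where
  "0 = Word []"

definition plus_free_monoid :: "'a free_monoid \<Rightarrow> 'a free_monoid \<Rightarrow> 'a free_monoid" where
  "u + v = Word (letters u @ letters v)"

instance
  by standard (simp_all add: zero_free_monoid_def plus_free_monoid_def)

end

datatype weyl_generator = Gen_x | Gen_d

text \<open>
  The free algebra is the monoid algebra of the free monoid on the generators: multiplication on
  \<^typ>\<open>'w \<Rightarrow>\<^sub>0 'k\<close> is convolution.
\<close>

type_synonym 'k free_alg = "weyl_generator free_monoid \<Rightarrow>\<^sub>0 'k"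
type_synonym 'k weyl = "'k free_alg set"

definition free_const :: "'k::field \<Rightarrow> 'k free_alg" where
  "free_const c = Poly_Mapping.single 0 c"

definition free_gen :: "weyl_generator \<Rightarrow> 'k::field free_alg" where
  "free_gen g = Poly_Mapping.single (Word [g]) 1"

definition weyl_ideal :: "'k::field free_alg set" where
  "weyl_ideal =
     genideal ring_of_type_algebra {free_gen Gen_d * free_gen Gen_x - free_gen Gen_x * free_gen Gen_d - 1}"

definition weyl_algebra :: "'k::field weyl ring" where
  "weyl_algebra = ring_of_type_algebra Quot weyl_ideal"

definition weyl_class :: "'k::field free_alg \<Rightarrow> 'k weyl" where
  "weyl_class f = weyl_ideal +>\<^bsub>ring_of_type_algebra\<^esub> f"

definition weyl_const :: "'k::field \<Rightarrow> 'k weyl" where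
  "weyl_const c = weyl_class (free_const c)"

definition weyl_x :: "'k::field weyl" where
  "weyl_x = weyl_class (free_gen Gen_x)"

definition weyl_d :: "'k::field weyl" where
  "weyl_d = weyl_class (free_gen Gen_d)"

definition weyl_alg_endos :: "('k::field weyl \<Rightarrow> 'k weyl) set" where
  "weyl_alg_endos =
     {\<phi> \<in> ring_hom weyl_algebra weyl_algebra. \<forall>c. \<phi> (weyl_const c) = weyl_const c}"

definition is_phi :: "nat \<Rightarrow> ('k::field weyl \<Rightarrow> 'k weyl) \<Rightarrow> bool" where
  "is_phi p \<phi> \<longleftrightarrow> \<phi> \<in> weyl_alg_endos \<and>
     \<phi> weyl_x = weyl_x \<and>
     \<phi> weyl_d = weyl_d \<oplus>\<^bsub>weyl_algebra\<^esub>
       (weyl_x [^]\<^bsub>weyl_algebra\<^esub> (p - 1)) \<otimes>\<^bsub>weyl_algebra\<^esub> (weyl_d [^]\<^bsub>weyl_algebra\<^esub> p)"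

end

theory Submission
  imports Defs "HOL-Number_Theory.Residues"
begin

text \<open>
  Let \<open>V = A\<^sub>1 / x A\<^sub>1\<close>, that is \<open>k[t]\<close> with \<open>x\<close> acting from the right as \<open>d/dt\<close> and
  \<open>\<partial>\<close> as \<open>t\<close>. Multiplication by \<open>t\<^sup>p\<close> is an injective endomorphism of \<open>V\<close>, because
  \<open>\<partial>\<^sup>p\<close> is central. Modulo \<open>x A\<^sub>1\<close> one has \<open>\<phi>(\<partial>)\<^sup>n = \<partial>\<^sup>n\<close> for \<open>n < p\<close>, and then
  \<open>\<phi>(\<partial>)\<^sup>p = (1 + (p - 1)!) \<partial>\<^sup>p = 0\<close> by Wilson's theorem, say \<open>\<phi>(\<partial>)\<^sup>p = x c\<close>. So in
  \<open>V \<otimes> A\<^sub>1\<close> the induced map sends \<open>1 \<otimes> 1\<close> to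
  \<open>t\<^sup>p \<otimes> 1 = 1 \<otimes> \<phi>(\<partial>)\<^sup>p = 1 \<otimes> \<phi>(x) c = 1 . x \<otimes> c = 0\<close>. But \<open>1 \<otimes> 1 \<noteq> 0\<close>: truncation
  \<open>\<theta>\<close> modulo \<open>t\<^sup>p\<close> satisfies \<open>\<theta>(P . s) = \<theta>(P) . \<phi>(s)\<close>, so \<open>(P, s) \<mapsto> \<theta>(P) . s\<close> is
  balanced, and it maps \<open>(1, 1)\<close> to \<open>1\<close>. Hence \<open>\<phi>\<close> is not left flat.
\<close>

section \<open>The free algebra and its linear maps\<close>

text \<open>The scalar action \<open>sc\<close> is a parameter so that one construction serves
  substitutions in the free algebra, the action on polynomials and maps out of free abelian
  groups.\<close>

definition lin_ext :: "('c::zero \<Rightarrow> 'v \<Rightarrow> 'v) \<Rightarrow> ('a \<Rightarrow> 'v) \<Rightarrow> ('a \<Rightarrow>\<^sub>0 'c) \<Rightarrow> 'v::comm_monoid_add" where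
  "lin_ext sc g f = (\<Sum>w\<in>Poly_Mapping.keys f. sc (Poly_Mapping.lookup f w) (g w))"

lemma lin_ext_single:
  assumes "\<And>v. sc 0 v = 0"
  shows "lin_ext sc g (Poly_Mapping.single w c) = sc c (g w)"
  using assms by (simp add: lin_ext_def)

text \<open>Cancellation can make the keys of a sum smaller than the union of the keys, so
  additivity is proved over a common finite superset.\<close>

lemma lin_ext_superset:
  assumes "\<And>v. sc 0 v = 0" and "finite A" and "Poly_Mapping.keys f \<subseteq> A"
  shows "lin_ext sc g f = (\<Sum>w\<in>A. sc (Poly_Mapping.lookup f w) (g w))"
  unfolding lin_ext_def
  by (rule sum.mono_neutral_left) (use assms in \<open>auto simp: in_keys_iff\<close>)

lemma lin_ext_add:
  assumes "\<And>v. sc 0 v = 0" and "\<And>a b v. sc (a + b) v = sc a v + sc b v"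
  shows "lin_ext sc g (f + h) = lin_ext sc g f + lin_ext sc g h"
proof -
  let ?A = "Poly_Mapping.keys f \<union> Poly_Mapping.keys h"
  have "finite ?A" "Poly_Mapping.keys (f + h) \<subseteq> ?A"
    by (simp_all add: Poly_Mapping.keys_add)
  then show ?thesis
    using assms
    by (simp add: lin_ext_superset[where A = ?A] lookup_add sum.distrib)
qed

section \<open>Induction over monomials and over algebra expressions\<close>

lemma poly_mapping_single_sum:
  "f = (\<Sum>w\<in>Poly_Mapping.keys f. Poly_Mapping.single w (Poly_Mapping.lookup f w))"
proof (rule poly_mapping_eqI)
  fix v
  show "Poly_Mapping.lookup f v =
    Poly_Mapping.lookup (\<Sum>w\<in>Poly_Mapping.keys f. Poly_Mapping.single w (Poly_Mapping.lookup f w)) v"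
    by (cases "v \<in> Poly_Mapping.keys f")
      (auto simp: lookup_sum lookup_single when_def in_keys_iff sum.delta)
qed

lemma poly_mapping_single_induct [case_names single add]:
  fixes P :: "('a \<Rightarrow>\<^sub>0 'b::comm_monoid_add) \<Rightarrow> bool"
  assumes "\<And>w c. P (Poly_Mapping.single w c)" and "\<And>f g. P f \<Longrightarrow> P g \<Longrightarrow> P (f + g)"
  shows "P f"
proof -
  have "P (\<Sum>w\<in>A. Poly_Mapping.single w (h w))" if "finite A" for A h
    using that
  proof induction
    case empty
    \<comment> \<open>Zero is \<open>single w 0\<close> for an arbitrary word
      \<open>w\<close>.\<close>
    show ?case using assms(1)[of undefined 0] by simp
  qed (simp add: assms)
  then show ?thesis
    using poly_mapping_single_sum[of f] by (metis finite_keys)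
qed

lemma free_const_simps [simp]:
  "free_const 0 = 0" "free_const 1 = 1"
  "free_const (a + b) = free_const a + free_const b"
  "free_const (a * b) = free_const a * free_const b"
  "free_const (- a) = - free_const a"
  by (simp_all add: free_const_def single_add mult_single single_uminus)

lemma free_const_central: "free_const c * f = f * free_const c"
  by (induction f rule: poly_mapping_single_induct)
    (simp_all add: free_const_def mult_single algebra_simps)

lemma free_const_of_nat: "free_const (of_nat n) = of_nat n"
  by (simp add: free_const_def)

lemma single_word:
  "Poly_Mapping.single w c = free_const c * prod_list (map free_gen (letters w))"
proof (induction w)
  case (Word l)
  have "Poly_Mapping.single (Word l) 1 = prod_list (map free_gen l :: 'a free_alg list)"
  proof (induction l)
    case Nil
    then show ?case by (simp flip: zero_free_monoid_def)
  next
    case (Cons a l)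
    have "Poly_Mapping.single (Word (a # l)) (1::'a) =
        free_gen a * Poly_Mapping.single (Word l) 1"
      by (simp add: free_gen_def mult_single plus_free_monoid_def)
    with Cons show ?case by simp
  qed
  moreover have "Poly_Mapping.single (Word l) c = free_const c * Poly_Mapping.single (Word l) 1"
    by (simp add: free_const_def mult_single)
  ultimately show ?case by simp
qed

text \<open>Every element is a sum of constants times words in the generators. Identities compatible
  with sums and products can thus be checked on constants and generators.\<close>

lemma free_alg_induct [case_names const gen add mult]:
  fixes f :: "'k::field free_alg"
  assumes const: "\<And>c. P (free_const c)" and gen: "\<And>g. P (free_gen g)"
    and add: "\<And>f g. P f \<Longrightarrow> P g \<Longrightarrow> P (f + g)"
    and mult: "\<And>f g. P f \<Longrightarrow> P g \<Longrightarrow> P (f * g)"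
  shows "P f"
proof (induction f rule: poly_mapping_single_induct)
  case (single w c)
  have "P (prod_list (map free_gen l))" for l
  proof (induction l)
    case Nil
    show ?case using const[of 1] by simp
  qed (simp add: gen mult)
  then show ?case
    by (simp add: single_word const mult)
qed (rule add)

section \<open>Endomorphisms of the free algebra from its universal property\<close>

definition free_subst :: "(weyl_generator \<Rightarrow> 'k::field free_alg) \<Rightarrow> 'k free_alg \<Rightarrow> 'k free_alg" where
  "free_subst g = lin_ext (\<lambda>c v. free_const c * v) (\<lambda>w. prod_list (map g (letters w)))"

lemma free_subst_single:
  "free_subst g (Poly_Mapping.single w c) = free_const c * prod_list (map g (letters w))"
  by (simp add: free_subst_def lin_ext_single)

lemma free_subst_add: "free_subst g (f + h) = free_subst g f + free_subst g h"
  by (simp add: free_subst_def lin_ext_add algebra_simps)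

lemma free_subst_const [simp]: "free_subst g (free_const c) = free_const c"
  by (simp add: free_const_def free_subst_single zero_free_monoid_def)

lemma free_subst_gen [simp]: "free_subst g (free_gen a) = g a"
  by (simp add: free_gen_def free_subst_single)

text \<open>Additivity in both arguments reduces this to monomials, where centrality of constants
  lets the coefficient \<open>b\<close> pass the image of the word \<open>u\<close>.\<close>

lemma free_subst_mult: "free_subst g (f * h) = free_subst g f * free_subst g h"
proof (induction f rule: poly_mapping_single_induct)
  case (single u a)
  show ?case
  proof (induction h rule: poly_mapping_single_induct)
    case (single v b)
    have "free_const a * free_const b * (prod_list (map g (letters u)) * prod_list (map g (letters v)))
      = free_const a * (free_const b * prod_list (map g (letters u))) * prod_list (map g (letters v))"
      by (simp add: mult.assoc)
    also have "\<dots> = free_const a * prod_list (map g (letters u)) * (free_const b * prod_list (map g (letters v)))"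
      by (simp add: free_const_central[of b] mult.assoc)
    finally show ?case
      by (simp add: mult_single free_subst_single plus_free_monoid_def)
  qed (simp add: algebra_simps free_subst_add)
qed (simp add: algebra_simps free_subst_add)

lemma free_subst_diff: "free_subst g (f - h) = free_subst g f - free_subst g h"
  using free_subst_add[of g "f - h" h] by (simp add: eq_diff_eq)

lemma free_subst_one [simp]: "free_subst g 1 = 1"
  using free_subst_const[of g 1] by simp


section \<open>The Weyl algebra as a quotient\<close>

lemma ring_of_type_algebra_simps [simp]:
  "carrier ring_of_type_algebra = UNIV"
  "x \<otimes>\<^bsub>ring_of_type_algebra\<^esub> y = x * y"
  "\<one>\<^bsub>ring_of_type_algebra\<^esub> = 1"
  "\<zero>\<^bsub>ring_of_type_algebra\<^esub> = 0"
  "x \<oplus>\<^bsub>ring_of_type_algebra\<^esub> y = x + y"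
  by (simp_all add: ring_of_type_algebra_def)

lemma ring_of_type_algebra_ring: "ring (ring_of_type_algebra :: 'a::ring_1 ring)"
proof -
  have "\<exists>y. x + y = 0" for x :: 'a
    using add.right_inverse by blast
  then show ?thesis
    unfolding ring_of_type_algebra_def using add.right_inverse
    by unfold_locales (auto simp: algebra_simps Units_def)
qed

lemma ring_of_type_algebra_minus [simp]:
  "\<ominus>\<^bsub>ring_of_type_algebra\<^esub> x = - (x :: 'a::ring_1)"
proof -
  interpret ring "ring_of_type_algebra :: 'a ring" by (rule ring_of_type_algebra_ring)
  show ?thesis by (rule minus_equality) simp_all
qed

text \<open>Additive inverses come from absorbing the factor \<open>- 1\<close>.\<close>

lemma ideal_of_type_algebraI:
  fixes I :: "'a::ring_1 set"
  assumes "0 \<in> I" and "\<And>f g. f \<in> I \<Longrightarrow> g \<in> I \<Longrightarrow> f + g \<in> I"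
    and l: "\<And>f h. f \<in> I \<Longrightarrow> h * f \<in> I" and r: "\<And>f h. f \<in> I \<Longrightarrow> f * h \<in> I"
  shows "ideal I ring_of_type_algebra"
proof (rule idealI)
  show "subgroup I (add_monoid (ring_of_type_algebra :: 'a ring))"
  proof
    fix x assume "x \<in> I"
    have "inv\<^bsub>add_monoid ring_of_type_algebra\<^esub> x = - x"
      using ring_of_type_algebra_minus[of x] by (simp add: a_inv_def)
    then show "inv\<^bsub>add_monoid ring_of_type_algebra\<^esub> x \<in> I"
      using l[OF \<open>x \<in> I\<close>, of "- 1"] by simp
  qed (use assms in auto)
qed (use ring_of_type_algebra_ring l r in auto)

lemma weyl_ideal_ideal: "ideal weyl_ideal ring_of_type_algebra"
  unfolding weyl_ideal_def by (rule ring.genideal_ideal[OF ring_of_type_algebra_ring]) simp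

lemma weyl_ideal_relation:
  "free_gen Gen_d * free_gen Gen_x - free_gen Gen_x * free_gen Gen_d - 1 \<in> weyl_ideal"
  unfolding weyl_ideal_def by (rule ring.genideal_self'[OF ring_of_type_algebra_ring]) simp

text \<open>The device for proving a property of all of \<open>weyl_ideal\<close>: the elements
  having it are shown to form a two-sided ideal containing the relation.\<close>

lemma weyl_ideal_minimal:
  assumes "ideal I ring_of_type_algebra"
    and "free_gen Gen_d * free_gen Gen_x - free_gen Gen_x * free_gen Gen_d - 1 \<in> I"
  shows "weyl_ideal \<subseteq> I"
  unfolding weyl_ideal_def
  using ring.genideal_minimal[OF ring_of_type_algebra_ring assms(1)] assms(2) by simp

lemma weyl_ideal_mult:
  assumes "f \<in> weyl_ideal"
  shows "h * f \<in> weyl_ideal" and "f * h \<in> weyl_ideal"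
  using ideal.I_l_closed[OF weyl_ideal_ideal assms, of h]
    ideal.I_r_closed[OF weyl_ideal_ideal assms, of h] by simp_all

lemma weyl_ideal_zero: "0 \<in> weyl_ideal"
  using weyl_ideal_mult(1)[OF weyl_ideal_relation, of 0] by simp

lemma weyl_ideal_add: "f \<in> weyl_ideal \<Longrightarrow> g \<in> weyl_ideal \<Longrightarrow> f + g \<in> weyl_ideal"
  using additive_subgroup.a_closed[OF ideal.axioms(1)[OF weyl_ideal_ideal]] by fastforce

lemma weyl_ring: "ring weyl_algebra"
  unfolding weyl_algebra_def by (rule ideal.quotient_is_ring[OF weyl_ideal_ideal])

lemma weyl_class_hom: "weyl_class \<in> ring_hom ring_of_type_algebra weyl_algebra"
  using ideal.rcos_ring_hom[OF weyl_ideal_ideal]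
  unfolding weyl_algebra_def weyl_class_def[abs_def] .

lemma weyl_class_closed [simp]: "weyl_class f \<in> carrier weyl_algebra"
  using ring_hom_closed[OF weyl_class_hom] by simp

lemma weyl_class_add: "weyl_class (f + g) = weyl_class f \<oplus>\<^bsub>weyl_algebra\<^esub> weyl_class g"
  using ring_hom_add[OF weyl_class_hom] by simp

lemma weyl_class_mult: "weyl_class (f * g) = weyl_class f \<otimes>\<^bsub>weyl_algebra\<^esub> weyl_class g"
  using ring_hom_mult[OF weyl_class_hom] by simp

lemma weyl_class_one: "weyl_class 1 = \<one>\<^bsub>weyl_algebra\<^esub>"
  using ring_hom_one[OF weyl_class_hom] by simp

lemma weyl_class_power: "weyl_class (f ^ n) = weyl_class f [^]\<^bsub>weyl_algebra\<^esub> n"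
  by (induction n) (simp_all add: weyl_class_one weyl_class_mult power_Suc2 del: power_Suc)

lemma weyl_carrierE:
  assumes "s \<in> carrier weyl_algebra"
  obtains f where "s = weyl_class f"
  using assms unfolding weyl_algebra_def FactRing_def A_RCOSETS_def' weyl_class_def by auto

lemma weyl_class_eq_iff: "weyl_class f = weyl_class g \<longleftrightarrow> f - g \<in> weyl_ideal"
  using ring.quotient_eq_iff_same_a_r_cos[OF ring_of_type_algebra_ring weyl_ideal_ideal, of f g]
  by (simp add: weyl_class_def a_minus_def)

lemma weyl_class_self: "f \<in> weyl_class f"
  unfolding weyl_class_def
  by (rule abelian_subgroup.a_rcos_self)
    (use ideal.axioms(1)[OF weyl_ideal_ideal] ring_of_type_algebra_ring in
      \<open>auto intro: abelian_subgroupI3 ring.is_abelian_group\<close>)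

definition weyl_rep :: "'k::field weyl \<Rightarrow> 'k free_alg" where
  "weyl_rep s = (SOME f. f \<in> s)"

text \<open>A map defined through \<open>weyl_rep\<close> can therefore be computed on
  \<open>weyl_class f\<close> from \<open>f\<close> itself, as soon as it respects the
  ideal.\<close>

lemma weyl_rep_class: "weyl_rep (weyl_class f) - f \<in> weyl_ideal"
proof -
  have "weyl_rep (weyl_class f) \<in> weyl_class f"
    unfolding weyl_rep_def by (rule someI) (rule weyl_class_self)
  then show ?thesis
    by (auto simp: weyl_class_def a_r_coset_def')
qed

text \<open>The commutator with \<open>x\<close> is a derivation sending \<open>\<partial>\<close>
  to 1. For \<open>n = CHAR('k)\<close> the coefficient vanishes, so
  \<open>\<partial>\<^sup>p\<close> commutes with \<open>x\<close>.\<close>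

lemma weyl_commutator_power:
  "free_gen Gen_d ^ n * free_gen Gen_x - free_gen Gen_x * free_gen Gen_d ^ n
     - of_nat n * free_gen Gen_d ^ (n - 1) \<in> weyl_ideal"
proof (induction n)
  case (Suc n)
  let ?d = "free_gen Gen_d :: 'a free_alg" and ?x = "free_gen Gen_x :: 'a free_alg"
  \<comment> \<open>For \<open>n = 0\<close> the exponent \<open>n - 1\<close> is truncated to 0,
    but the coefficient is zero.\<close>
  have eq: "?d * (of_nat n * ?d ^ (n - 1)) = of_nat n * ?d ^ n"
  proof (cases n)
    case (Suc k)
    have "?d * (of_nat n * ?d ^ k) = (of_nat n * ?d) * ?d ^ k"
      by (simp only: mult_of_nat_commute mult.assoc)
    then show ?thesis
      using Suc by (simp add: mult.assoc)
  qed simp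
  have "?d ^ Suc n * ?x - ?x * ?d ^ Suc n - of_nat (Suc n) * ?d ^ (Suc n - 1) =
      ?d * (?d ^ n * ?x - ?x * ?d ^ n - of_nat n * ?d ^ (n - 1))
       + (?d * ?x - ?x * ?d - 1) * ?d ^ n"
    using eq by (simp add: algebra_simps)
  then show ?case
    using weyl_ideal_add[OF weyl_ideal_mult(1)[OF Suc] weyl_ideal_mult(2)[OF weyl_ideal_relation]]
    by simp
qed (simp add: weyl_ideal_zero)


section \<open>The endomorphism\<close>

lemma free_alg_of_nat_CHAR: "(of_nat CHAR('k) :: 'k::field free_alg) = 0"
  by (simp flip: free_const_of_nat)

text \<open>Wilson's theorem, carried from congruences modulo the characteristic, which is prime, to
  the field.\<close>

lemma of_nat_fact_pred_CHAR:
  assumes "CHAR('k::field) > 0"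
  shows "of_nat (fact (CHAR('k) - 1)) = (- 1 :: 'k)"
proof -
  have "[fact (CHAR('k) - 1) = - 1] (mod int CHAR('k))"
    by (rule wilson_theorem) (use assms prime_CHAR_semidom in blast)
  then have "(of_int (fact (CHAR('k) - 1)) :: 'k) = of_int (- 1)"
    by (simp only: of_int_eq_iff_cong_CHAR)
  moreover have "(of_nat (fact (CHAR('k) - 1)) :: 'k) = of_int (fact (CHAR('k) - 1))"
    by (metis of_int_of_nat_eq of_nat_fact)
  ultimately show ?thesis by simp
qed

definition phi_gen :: "nat \<Rightarrow> weyl_generator \<Rightarrow> 'k::field free_alg" where
  "phi_gen p a = (case a of
     Gen_x \<Rightarrow> free_gen Gen_x
   | Gen_d \<Rightarrow> free_gen Gen_d + free_gen Gen_x ^ (p - 1) * free_gen Gen_d ^ p)"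

lemma phi_gen_simps [simp]:
  "phi_gen p Gen_x = free_gen Gen_x"
  "phi_gen p Gen_d = free_gen Gen_d + free_gen Gen_x ^ (p - 1) * free_gen Gen_d ^ p"
  by (simp_all add: phi_gen_def)

lemma weyl_class_phi_gen_d:
  "weyl_class (phi_gen p Gen_d) = weyl_d \<oplus>\<^bsub>weyl_algebra\<^esub>
     (weyl_x [^]\<^bsub>weyl_algebra\<^esub> (p - 1)) \<otimes>\<^bsub>weyl_algebra\<^esub> (weyl_d [^]\<^bsub>weyl_algebra\<^esub> p)"
  by (simp add: weyl_class_add weyl_class_mult weyl_class_power weyl_x_def weyl_d_def)

text \<open>The added term \<open>x^(p-1) \<partial>\<^sup>p\<close> commutes with \<open>x\<close>
  modulo the ideal, so it does not change the commutator.\<close>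

lemma phi_gen_relation:
  "phi_gen CHAR('k) Gen_d * phi_gen CHAR('k) Gen_x - phi_gen CHAR('k) Gen_x * phi_gen CHAR('k) Gen_d - 1
     \<in> (weyl_ideal :: 'k::field free_alg set)"
proof -
  let ?p = "CHAR('k)"
  let ?x = "free_gen Gen_x :: 'k free_alg" and ?d = "free_gen Gen_d :: 'k free_alg"
  have comm: "?d ^ ?p * ?x - ?x * ?d ^ ?p \<in> weyl_ideal"
    using weyl_commutator_power[where 'a = 'k, of ?p] by (simp add: free_alg_of_nat_CHAR)
  have "?x * (?x ^ (?p - 1) * ?d ^ ?p) = ?x ^ (?p - 1) * (?x * ?d ^ ?p)"
    using power_commutes[of ?x "?p - 1"] by (simp flip: mult.assoc)
  then have "phi_gen ?p Gen_d * phi_gen ?p Gen_x - phi_gen ?p Gen_x * phi_gen ?p Gen_d - 1 =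
      (?d * ?x - ?x * ?d - 1) + ?x ^ (?p - 1) * (?d ^ ?p * ?x - ?x * ?d ^ ?p)"
    by (simp add: algebra_simps)
  then show ?thesis
    by (simp only: weyl_ideal_add weyl_ideal_relation weyl_ideal_mult comm)
qed

text \<open>The preimage of \<open>weyl_ideal\<close> under the substitution is an ideal, and by
  assumption it contains the relation.\<close>

lemma free_subst_weyl_ideal:
  assumes "g Gen_d * g Gen_x - g Gen_x * g Gen_d - 1 \<in> weyl_ideal" and "f \<in> weyl_ideal"
  shows "free_subst g f \<in> weyl_ideal"
proof -
  let ?I = "{f. free_subst g f \<in> weyl_ideal}"
  have "ideal ?I ring_of_type_algebra"
    using free_subst_const[of g 0]
    by (intro ideal_of_type_algebraI)
      (auto simp: free_subst_add free_subst_mult weyl_ideal_zero weyl_ideal_add weyl_ideal_mult)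
  then have "weyl_ideal \<subseteq> ?I"
    by (rule weyl_ideal_minimal) (use assms(1) in \<open>simp add: free_subst_diff free_subst_mult\<close>)
  with assms(2) show ?thesis by auto
qed

text \<open>The universal property of the Weyl algebra. The substitution is applied to chosen
  representatives, and \<open>cls\<close> shows that the choice does not matter.\<close>

lemma weyl_endo_exists:
  fixes g :: "weyl_generator \<Rightarrow> 'k::field free_alg"
  assumes rel: "g Gen_d * g Gen_x - g Gen_x * g Gen_d - 1 \<in> weyl_ideal"
  obtains \<phi> :: "'k weyl \<Rightarrow> 'k weyl" where "\<phi> \<in> weyl_alg_endos" "\<phi> weyl_x = weyl_class (g Gen_x)" "\<phi> weyl_d = weyl_class (g Gen_d)"
proof
  let ?\<phi> = "\<lambda>s :: 'k weyl. weyl_class (free_subst g (weyl_rep s))"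
  have cls: "?\<phi> (weyl_class f) = weyl_class (free_subst g f)" for f
    unfolding weyl_class_eq_iff free_subst_diff[symmetric]
    by (intro free_subst_weyl_ideal rel weyl_rep_class)
  have "?\<phi> \<in> ring_hom weyl_algebra weyl_algebra"
  proof (rule ring_hom_memI)
    fix s t :: "'k weyl" assume "s \<in> carrier weyl_algebra" "t \<in> carrier weyl_algebra"
    then obtain f h where "s = weyl_class f" "t = weyl_class h"
      by (auto elim!: weyl_carrierE)
    then show "?\<phi> (s \<otimes>\<^bsub>weyl_algebra\<^esub> t) = ?\<phi> s \<otimes>\<^bsub>weyl_algebra\<^esub> ?\<phi> t"
      and "?\<phi> (s \<oplus>\<^bsub>weyl_algebra\<^esub> t) = ?\<phi> s \<oplus>\<^bsub>weyl_algebra\<^esub> ?\<phi> t"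
      by (simp_all add: cls free_subst_mult free_subst_add flip: weyl_class_mult weyl_class_add)
  qed (simp_all add: cls flip: weyl_class_one)
  then show "?\<phi> \<in> weyl_alg_endos"
    by (simp add: weyl_alg_endos_def weyl_const_def cls)
  show "?\<phi> weyl_x = weyl_class (g Gen_x)" "?\<phi> weyl_d = weyl_class (g Gen_d)"
    by (simp_all add: weyl_x_def weyl_d_def cls)
qed

text \<open>This ensures that a statement about all \<open>\<phi>\<close> satisfying
  \<open>is_phi\<close> is not vacuous.\<close>

lemma is_phi_exists: "\<exists>\<phi> :: 'k::field weyl \<Rightarrow> 'k weyl. is_phi CHAR('k) \<phi>"
proof -
  obtain \<phi> :: "'k weyl \<Rightarrow> 'k weyl" where "\<phi> \<in> weyl_alg_endos"
    "\<phi> weyl_x = weyl_class (phi_gen CHAR('k) Gen_x)"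
    "\<phi> weyl_d = weyl_class (phi_gen CHAR('k) Gen_d)"
    by (rule weyl_endo_exists[OF phi_gen_relation])
  then have "is_phi CHAR('k) \<phi>"
    unfolding is_phi_def weyl_class_phi_gen_d by (simp add: weyl_x_def)
  then show ?thesis by blast
qed


subsection \<open>The image of \<open>\<partial>\<close> modulo the right ideal generated by \<open>x\<close>\<close>

text \<open>The preimage in the free algebra of the right ideal \<open>x A\<^sub>1\<close>:
  membership means vanishing in \<open>A\<^sub>1 / x A\<^sub>1\<close>.\<close>

definition x_multiples :: "'k::field free_alg set" where
  "x_multiples = {f. \<exists>a. f - free_gen Gen_x * a \<in> weyl_ideal}"

lemma x_multiples_x: "free_gen Gen_x * a \<in> x_multiples"
  unfolding x_multiples_def using weyl_ideal_zero by (auto intro!: exI[of _ a])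

lemma weyl_ideal_subset_x_multiples: "f \<in> weyl_ideal \<Longrightarrow> f \<in> x_multiples"
  unfolding x_multiples_def by (auto intro: exI[of _ 0])

lemma x_multiples_zero: "0 \<in> x_multiples"
  using x_multiples_x[of 0] by simp

lemma x_multiples_add:
  assumes "f \<in> x_multiples" "g \<in> x_multiples"
  shows "f + g \<in> x_multiples"
proof -
  from assms obtain a b where "f - free_gen Gen_x * a \<in> weyl_ideal" "g - free_gen Gen_x * b \<in> weyl_ideal"
    unfolding x_multiples_def by blast
  then have "(f + g) - free_gen Gen_x * (a + b) \<in> weyl_ideal"
    using weyl_ideal_add[of "f - free_gen Gen_x * a" "g - free_gen Gen_x * b"]
    by (simp add: algebra_simps)
  then show ?thesis unfolding x_multiples_def by blast
qed

lemma x_multiples_mult: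
  assumes "f \<in> x_multiples"
  shows "f * h \<in> x_multiples"
proof -
  from assms obtain a where "f - free_gen Gen_x * a \<in> weyl_ideal"
    unfolding x_multiples_def by blast
  from weyl_ideal_mult(2)[OF this, of h] have "f * h - free_gen Gen_x * (a * h) \<in> weyl_ideal"
    by (simp add: algebra_simps)
  then show ?thesis unfolding x_multiples_def by blast
qed

text \<open>In \<open>A\<^sub>1 / x A\<^sub>1\<close>, viewed as \<open>k[t]\<close>, the product is
  the \<open>m\<close>-th derivative of \<open>t\<^sup>n\<close>: zero for \<open>n < m\<close> and
  \<open>n!\<close> for \<open>n = m\<close>.\<close>

lemma d_power_x_power:
  "n \<le> m \<Longrightarrow> free_gen Gen_d ^ n * free_gen Gen_x ^ m - (if n = m then of_nat (fact n) else 0)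
     \<in> (x_multiples :: 'k::field free_alg set)"
proof (induction m arbitrary: n)
  case 0
  then show ?case by (simp add: x_multiples_zero)
next
  case (Suc m)
  let ?x = "free_gen Gen_x :: 'k free_alg" and ?d = "free_gen Gen_d :: 'k free_alg"
  show ?case
  proof (cases n)
    case 0
    then show ?thesis using x_multiples_x[of "?x ^ m"] by simp
  next
    case (Suc k)
    \<comment> \<open>The constant of the induction hypothesis for \<open>k\<close> and
      \<open>m\<close>; multiplied by \<open>n = k + 1\<close> it becomes the one required for
      \<open>n\<close> and \<open>m + 1\<close>.\<close>
    define e :: nat where "e = (if k = m then fact k else 0)"
    have IH: "?d ^ k * ?x ^ m - of_nat e \<in> x_multiples"
      using Suc.IH[of k] Suc.prems Suc by (auto simp: e_def)
    have e: "(if n = Suc m then of_nat (fact n) else 0) = (of_nat e * of_nat n :: 'k free_alg)"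
      using Suc by (simp add: e_def mult.commute flip: of_nat_mult del: of_nat_Suc)
    \<comment> \<open>The closure lemma \<open>x_multiples_mult\<close> concerns right factors, so
      the integer is moved to the right.\<close>
    have "of_nat n * (?d ^ k * ?x ^ m) = ?d ^ k * ?x ^ m * of_nat n"
      by (rule mult_of_nat_commute)
    \<comment> \<open>One factor \<open>x\<close> is moved to the far left through
      \<open>\<partial>\<^sup>n\<close>; the commutator contributes
      \<open>n \<partial>\<^sup>k\<close>.\<close>
    then have "?d ^ n * ?x ^ Suc m - of_nat e * of_nat n =
        (?d ^ n * ?x - ?x * ?d ^ n - of_nat n * ?d ^ k) * ?x ^ m
         + ?x * (?d ^ n * ?x ^ m) + (?d ^ k * ?x ^ m - of_nat e) * of_nat n"
      by (simp add: algebra_simps)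
    moreover have "(?d ^ n * ?x - ?x * ?d ^ n - of_nat n * ?d ^ k) \<in> x_multiples"
      using weyl_commutator_power[where 'a = 'k, of n] Suc weyl_ideal_subset_x_multiples by simp
    ultimately show ?thesis
      unfolding e using IH by (simp add: x_multiples_add x_multiples_mult x_multiples_x)
  qed
qed

text \<open>Splitting the last factor off on the right leaves the extra term
  \<open>\<partial>\<^sup>n x^(p-1) \<partial>\<^sup>p\<close>, which vanishes modulo
  \<open>x A\<^sub>1\<close> while \<open>n < p - 1\<close>.\<close>

lemma phi_gen_d_power:
  assumes "n < p"
  shows "phi_gen p Gen_d ^ n - free_gen Gen_d ^ n \<in> (x_multiples :: 'k::field free_alg set)"
  using assms
proof (induction n)
  case 0
  then show ?case by (simp add: x_multiples_zero)
next
  case (Suc n)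
  let ?x = "free_gen Gen_x :: 'k free_alg" and ?d = "free_gen Gen_d :: 'k free_alg"
  let ?D = "phi_gen p Gen_d :: 'k free_alg"
  have "?d ^ n * ?x ^ (p - 1) \<in> x_multiples"
  proof -
    have "n \<le> p - 1" "n \<noteq> p - 1"
      using Suc.prems by arith+
    then show ?thesis
      using d_power_x_power[where 'k = 'k, of n "p - 1"] by simp
  qed
  moreover have "?D ^ Suc n - ?d ^ Suc n = (?D ^ n - ?d ^ n) * ?D + ?d ^ n * ?x ^ (p - 1) * ?d ^ p"
    by (simp only: power_Suc2) (simp add: algebra_simps)
  moreover have "?D ^ n - ?d ^ n \<in> x_multiples"
    using Suc by simp
  ultimately show ?case
    by (simp add: x_multiples_add x_multiples_mult del: phi_gen_simps)
qed

text \<open>The last of the \<open>p\<close> factors is the first whose extra term survives. It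
  contributes \<open>(p - 1)! \<partial>\<^sup>p\<close>, which cancels
  \<open>\<partial>\<^sup>p\<close> by Wilson's theorem.\<close>

lemma phi_gen_d_power_CHAR:
  assumes "CHAR('k::field) > 0"
  shows "phi_gen CHAR('k) Gen_d ^ CHAR('k) \<in> (x_multiples :: 'k free_alg set)"
proof -
  let ?p = "CHAR('k)"
  let ?x = "free_gen Gen_x :: 'k free_alg" and ?d = "free_gen Gen_d :: 'k free_alg"
  let ?D = "phi_gen ?p Gen_d :: 'k free_alg"
  have p: "?p = Suc (?p - 1)"
    using assms by simp
  have "of_nat (fact (?p - 1)) = free_const (of_nat (fact (?p - 1)) :: 'k)"
    by (simp only: free_const_of_nat)
  then have wilson: "of_nat (fact (?p - 1)) = (- 1 :: 'k free_alg)"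
    by (simp only: of_nat_fact_pred_CHAR[OF assms] free_const_simps)
  have "?d ^ (?p - 1) * ?x ^ (?p - 1) + 1 \<in> x_multiples"
    using d_power_x_power[where 'k = 'k, of "?p - 1" "?p - 1"] unfolding wilson by simp
  moreover have "?D ^ (?p - 1) - ?d ^ (?p - 1) \<in> x_multiples"
    using phi_gen_d_power[of "?p - 1" ?p] assms by simp
  moreover have "?D ^ ?p = (?D ^ (?p - 1) - ?d ^ (?p - 1)) * ?D + (?d ^ (?p - 1) * ?x ^ (?p - 1) + 1) * ?d ^ ?p"
  proof -
    have "?D ^ ?p = ?D ^ (?p - 1) * ?D" "?d ^ ?p = ?d ^ (?p - 1) * ?d"
      using p by (metis power_Suc2)+
    then show ?thesis
      by (simp add: algebra_simps)
  qed
  ultimately show ?thesis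
    by (simp add: x_multiples_add x_multiples_mult del: phi_gen_simps)
qed


section \<open>The right module \<open>A\<^sub>1 / x A\<^sub>1\<close>\<close>

text \<open>Words act letter by letter starting from the left, since this is a right action.\<close>

definition gen_act :: "weyl_generator \<Rightarrow> 'k::field poly \<Rightarrow> 'k poly" where
  "gen_act a P = (case a of Gen_x \<Rightarrow> pderiv P | Gen_d \<Rightarrow> pCons 0 P)"

definition poly_act :: "'k::field free_alg \<Rightarrow> 'k poly \<Rightarrow> 'k poly" where
  "poly_act f P = lin_ext smult (\<lambda>w. fold gen_act (letters w) P) f"

lemma gen_act_add: "gen_act a (P + Q) = gen_act a P + gen_act a Q"
  by (cases a) (simp_all add: gen_act_def pderiv_add)

lemma gen_act_smult: "gen_act a (smult c P) = smult c (gen_act a P)"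
  by (cases a) (simp_all add: gen_act_def pderiv_smult)

lemma fold_gen_act_add: "fold gen_act l (P + Q) = fold gen_act l P + fold gen_act l Q"
  by (induction l arbitrary: P Q) (simp_all add: gen_act_add)

lemma fold_gen_act_smult: "fold gen_act l (smult c P) = smult c (fold gen_act l P)"
  by (induction l arbitrary: P) (simp_all add: gen_act_smult)

lemma poly_act_single:
  "poly_act (Poly_Mapping.single w c) P = smult c (fold gen_act (letters w) P)"
  by (simp add: poly_act_def lin_ext_single)

lemma poly_act_add: "poly_act (f + g) P = poly_act f P + poly_act g P"
  by (simp add: poly_act_def lin_ext_add smult_add_left)

lemma poly_act_add_right: "poly_act f (P + Q) = poly_act f P + poly_act f Q"
  by (induction f rule: poly_mapping_single_induct)
    (simp_all add: poly_act_single poly_act_add fold_gen_act_add smult_add_right)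

lemma poly_act_const [simp]: "poly_act (free_const c) P = smult c P"
  by (simp add: free_const_def poly_act_single zero_free_monoid_def)

lemma poly_act_gen [simp]:
  "poly_act (free_gen Gen_x) = pderiv" "poly_act (free_gen Gen_d) = pCons 0"
  by (simp_all add: fun_eq_iff free_gen_def poly_act_single gen_act_def)

lemma poly_act_mult: "poly_act (f * g) P = poly_act g (poly_act f P)"
proof (induction f rule: poly_mapping_single_induct)
  case (single u a)
  show ?case
    by (induction g rule: poly_mapping_single_induct)
      (simp_all add: mult_single poly_act_single plus_free_monoid_def fold_gen_act_smult
        distrib_left poly_act_add mult.commute)
qed (simp add: distrib_right poly_act_add poly_act_add_right)

lemma poly_act_one [simp]: "poly_act 1 P = P"
  using poly_act_const[of 1 P] by simp

lemma poly_act_zero [simp]: "poly_act 0 P = 0" "poly_act f 0 = 0"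
  using poly_act_const[of 0 P] poly_act_add_right[of f 0 0]
  by (simp, metis add.right_neutral add_left_cancel)

lemma poly_act_diff: "poly_act (f - g) P = poly_act f P - poly_act g P"
  using poly_act_add[of "f - g" g P] by (simp add: eq_diff_eq)

lemma poly_act_power: "poly_act (f ^ n) P = (poly_act f ^^ n) P"
  by (induction n) (simp_all add: power_Suc2 poly_act_mult del: power_Suc)

text \<open>The relation acts as zero by the product rule \<open>(t P)' = t P' + P\<close>, and the
  elements acting as zero form a two-sided ideal.\<close>

lemma poly_act_weyl_ideal:
  assumes "f \<in> weyl_ideal"
  shows "poly_act f P = 0"
proof -
  let ?I = "{f :: 'a free_alg. \<forall>P. poly_act f P = 0}"
  have "ideal ?I ring_of_type_algebra"
    by (rule ideal_of_type_algebraI) (simp_all add: poly_act_add poly_act_mult)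
  then have "weyl_ideal \<subseteq> ?I"
    by (rule weyl_ideal_minimal) (simp add: poly_act_diff poly_act_mult pderiv_pCons)
  with assms show ?thesis by auto
qed

definition weyl_act :: "'k::field weyl \<Rightarrow> 'k poly \<Rightarrow> 'k poly" where
  "weyl_act s = poly_act (weyl_rep s)"

lemma weyl_act_class: "weyl_act (weyl_class f) P = poly_act f P"
  using poly_act_weyl_ideal[OF weyl_rep_class[of f], of P]
  by (simp add: weyl_act_def poly_act_diff)

lemma weyl_act_zero [simp]: "weyl_act s 0 = 0"
  by (simp add: weyl_act_def)

lemma weyl_act_add_right: "weyl_act s (P + Q) = weyl_act s P + weyl_act s Q"
  by (simp add: weyl_act_def poly_act_add_right)

lemma weyl_act_one: "weyl_act \<one>\<^bsub>weyl_algebra\<^esub> P = P"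
  by (simp add: weyl_act_class flip: weyl_class_one)

lemma weyl_act_add:
  assumes "s \<in> carrier weyl_algebra" "t \<in> carrier weyl_algebra"
  shows "weyl_act (s \<oplus>\<^bsub>weyl_algebra\<^esub> t) P = weyl_act s P + weyl_act t P"
  using assms
  by (elim weyl_carrierE) (simp add: weyl_act_class poly_act_add flip: weyl_class_add)

lemma weyl_act_mult:
  assumes "s \<in> carrier weyl_algebra" "t \<in> carrier weyl_algebra"
  shows "weyl_act (s \<otimes>\<^bsub>weyl_algebra\<^esub> t) P = weyl_act t (weyl_act s P)"
  using assms
  by (elim weyl_carrierE) (simp add: weyl_act_class poly_act_mult flip: weyl_class_mult)

text \<open>Horner's scheme: acting by \<open>\<partial>\<close> and adding a constant prepends a
  coefficient. It makes every coset \<open>poly_coset P\<close> nonempty.\<close>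

lemma weyl_act_transitive: "\<exists>s\<in>carrier weyl_algebra. weyl_act s 1 = P"
proof -
  have "\<exists>f. poly_act f 1 = P"
  proof (induction P)
    case 0
    show ?case by (intro exI[of _ 0]) simp
  next
    case (pCons a P)
    then obtain f where "poly_act f 1 = P" by blast
    then have "poly_act (f * free_gen Gen_d + free_const a) 1 = pCons a P"
      by (simp add: poly_act_add poly_act_mult)
    then show ?case by blast
  qed
  then show ?thesis
    using weyl_act_class weyl_class_closed by metis
qed


subsection \<open>The quotient by \<open>t\<^sup>p\<close>\<close>

lemma poly_cutoff_add: "poly_cutoff n (P + Q) = poly_cutoff n P + poly_cutoff n Q"
  by (rule poly_eqI) (simp add: coeff_poly_cutoff)

lemma poly_cutoff_smult: "poly_cutoff n (smult c P) = smult c (poly_cutoff n P)"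
  by (rule poly_eqI) (simp add: coeff_poly_cutoff)

lemma poly_cutoff_idem [simp]: "poly_cutoff n (poly_cutoff n P) = poly_cutoff n P"
  by (rule poly_eqI) (simp add: coeff_poly_cutoff)

text \<open>Exactness in the middle: the kernel of truncation is the image of multiplication by
  \<open>t\<^sup>n\<close>.\<close>

lemma poly_cutoff_eq_0_iff: "poly_cutoff n P = 0 \<longleftrightarrow> (\<exists>Q. P = monom 1 n * Q)" for P :: "'k::field poly"
proof
  assume "poly_cutoff n P = 0"
  then have "coeff P i = 0" if "i < n" for i
    using that coeff_poly_cutoff[of n P i] by simp
  then have "P = monom 1 n * poly_shift n P"
    by (intro poly_eqI) (simp add: coeff_monom_mult coeff_poly_shift)
  then show "\<exists>Q. P = monom 1 n * Q" ..
qed (auto intro!: poly_eqI simp: coeff_poly_cutoff coeff_monom_mult)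

text \<open>The derivative of \<open>t\<^sup>p\<close> is zero, so multiplication by it commutes
  with both generators and hence is a module map.\<close>

lemma poly_act_monom_CHAR:
  "poly_act f (monom 1 CHAR('k) * P) = monom 1 CHAR('k) * poly_act f P" for f :: "'k::field free_alg"
proof (induction f arbitrary: P rule: free_alg_induct)
  case (gen g)
  then show ?case
    by (cases g) (simp_all add: pderiv_mult pderiv_monom)
qed (simp_all add: poly_act_add poly_act_mult distrib_left)

text \<open>The two sides could differ only in degree \<open>p - 1\<close>, where the derivative has
  \<open>p\<close> times the coefficient of \<open>t\<^sup>p\<close>.\<close>

lemma pderiv_poly_cutoff_CHAR:
  "pderiv (poly_cutoff CHAR('k) P) = poly_cutoff CHAR('k) (pderiv P)" for P :: "'k::field poly"
proof -
  have "of_nat (Suc n) = (0 :: 'k)" if "n < CHAR('k)" "\<not> Suc n < CHAR('k)" for n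
  proof -
    from that have "Suc n = CHAR('k)" by simp
    then show ?thesis by (simp only: of_nat_CHAR)
  qed
  then show ?thesis
    by (auto intro!: poly_eqI simp: coeff_poly_cutoff coeff_pderiv simp del: of_nat_Suc)
qed

text \<open>Expresses that the kernel of truncation is a submodule, so that the action descends to
  \<open>k[t] / t\<^sup>p\<close>.\<close>

lemma poly_cutoff_poly_act_cutoff:
  "poly_cutoff CHAR('k) (poly_act f (poly_cutoff CHAR('k) P)) = poly_cutoff CHAR('k) (poly_act f P)"
  for f :: "'k::field free_alg"
proof (induction f arbitrary: P rule: free_alg_induct)
  case (gen g)
  show ?case
    by (cases g)
      (auto intro!: poly_eqI simp: pderiv_poly_cutoff_CHAR coeff_poly_cutoff coeff_pCons split: nat.split)
next
  case (mult f g)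
  then show ?case by (metis poly_act_mult)
qed (simp_all add: poly_act_add poly_cutoff_add poly_cutoff_smult)

lemma funpow_pCons: "(pCons 0 ^^ n) P = monom 1 n * P" for P :: "'k::field poly"
  by (induction n) (simp_all add: monom_Suc)

text \<open>
  Only the coefficient \<open>c\<close> of \<open>t\<^sup>p\<^sup>-\<^sup>1\<close> matters here: truncation drops \<open>c t\<^sup>p\<close> from
  \<open>t P\<close>, while \<open>x\<^sup>p\<^sup>-\<^sup>1 \<partial>\<^sup>p\<close> contributes \<open>(p - 1)! c t\<^sup>p = - c t\<^sup>p\<close>.
\<close>

lemma poly_act_phi_gen_cutoff:
  assumes "CHAR('k::field) > 0"
  shows "poly_act (phi_gen CHAR('k) a) (poly_cutoff CHAR('k) P) =
    poly_cutoff CHAR('k) (poly_act (free_gen a) (P :: 'k poly))"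
proof (cases a)
  case Gen_x
  then show ?thesis
    by (simp add: pderiv_poly_cutoff_CHAR)
next
  case Gen_d
  let ?p = "CHAR('k)" and ?R = "poly_cutoff CHAR('k) P"
  let ?c = "coeff P (?p - 1)"
  have "(pderiv ^^ (?p - 1)) ?R = [:- ?c:]"
  proof (rule poly_eqI)
    fix n
    show "coeff ((pderiv ^^ (?p - 1)) ?R) n = coeff [:- ?c:] n"
    proof (cases n)
      case 0
      \<comment> \<open>By \<open>coeff_higher_pderiv\<close> the constant term is \<open>?c\<close>
        times this Pochhammer symbol, which is \<open>(p - 1)!\<close>.\<close>
      have "pochhammer 1 (?p - 1) = (- 1 :: 'k)"
        using of_nat_fact_pred_CHAR[OF assms] pochhammer_of_nat[where 'a = 'k, of 1 "?p - 1"]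
        by (simp add: pochhammer_fact)
      with 0 show ?thesis
        using assms by (simp add: coeff_higher_pderiv coeff_poly_cutoff)
    qed (use assms in \<open>simp add: coeff_higher_pderiv coeff_poly_cutoff\<close>)
  qed
  then have "poly_act (phi_gen ?p Gen_d) ?R = pCons 0 ?R + monom 1 ?p * [:- ?c:]"
    by (simp add: poly_act_add poly_act_mult poly_act_power funpow_pCons)
  also have "\<dots> = poly_cutoff ?p (pCons 0 P)"
    using assms
    by (intro poly_eqI) (auto simp: coeff_poly_cutoff coeff_monom_mult coeff_pCons split: nat.split)
  finally show ?thesis
    using Gen_d by simp
qed

section \<open>Truncation as a map compatible with restriction of scalars along
  \<open>\<phi>\<close>\<close>

lemma is_phi_props:
  assumes "is_phi p \<phi>"
  shows "\<phi> \<in> ring_hom weyl_algebra weyl_algebra"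
    and "\<phi> (weyl_class (free_const c)) = weyl_class (free_const c)"
    and "\<phi> (weyl_class (free_gen a)) = weyl_class (phi_gen p a)"
  using assms
  by (cases a; auto simp: is_phi_def weyl_alg_endos_def weyl_const_def weyl_x_def weyl_d_def
        weyl_class_add weyl_class_mult weyl_class_power)+

text \<open>Both sides respect sums and products in \<open>s\<close>, so constants and generators
  suffice. This gives the balancing condition for the map that detects
  \<open>1 \<otimes> 1\<close>.\<close>

lemma weyl_act_is_phi_cutoff:
  fixes \<phi> :: "'k::field weyl \<Rightarrow> 'k weyl"
  assumes \<phi>: "is_phi CHAR('k) \<phi>" and p: "CHAR('k) > 0" and s: "s \<in> carrier weyl_algebra"
  shows "weyl_act (\<phi> s) (poly_cutoff CHAR('k) P) = poly_cutoff CHAR('k) (weyl_act s P)"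
proof -
  note hom = is_phi_props(1)[OF \<phi>]
  have closed: "\<phi> (weyl_class f) \<in> carrier weyl_algebra" for f
    using ring_hom_closed[OF hom] by simp
  have "weyl_act (\<phi> (weyl_class f)) (poly_cutoff CHAR('k) P) = poly_cutoff CHAR('k) (poly_act f P)" for f
  proof (induction f arbitrary: P rule: free_alg_induct)
    case (const c)
    show ?case by (simp add: is_phi_props(2)[OF \<phi>] weyl_act_class poly_cutoff_smult)
  next
    case (gen g)
    show ?case by (simp add: is_phi_props(3)[OF \<phi>] weyl_act_class poly_act_phi_gen_cutoff[OF p])
  next
    case (add f g)
    then show ?case
      by (simp add: weyl_class_add ring_hom_add[OF hom] weyl_act_add closed poly_act_add poly_cutoff_add)
  next
    case (mult f g)
    then show ?case
      by (simp add: weyl_class_mult ring_hom_mult[OF hom] weyl_act_mult closed poly_act_mult)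
  qed
  then show ?thesis
    using s by (elim weyl_carrierE) (simp add: weyl_act_class)
qed


section \<open>Null elements of tensor products\<close>

lemma left_via_simps [simp]:
  "carrier (left_via T \<phi>) = carrier T" "add (left_via T \<phi>) = add T"
  "ring.zero (left_via T \<phi>) = \<zero>\<^bsub>T\<^esub>" "module.smult (left_via T \<phi>) s t = \<phi> s \<otimes>\<^bsub>T\<^esub> t"
  by (simp_all add: left_via_def)

lemma left_module_left_via:
  assumes "ring S" and "ring T" and \<phi>: "\<phi> \<in> ring_hom S T"
  shows "left_module S (left_via T \<phi>)"
proof -
  interpret S: ring S by fact
  interpret T: ring T by fact
  note closed = ring_hom_closed[OF \<phi>]
  have "abelian_group (left_via T \<phi>)"
    by (rule abelian_groupI) (auto simp: T.a_ac intro: T.add.l_inv_ex)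
  then show ?thesis
    by (intro left_module.intro left_module_axioms.intro S.ring_axioms)
      (auto simp: closed T.l_distr T.r_distr T.m_assoc ring_hom_add[OF \<phi>] ring_hom_mult[OF \<phi>]
        ring_hom_one[OF \<phi>])
qed

lemma keys_diff_subset:
  "Poly_Mapping.keys a \<subseteq> B \<Longrightarrow> Poly_Mapping.keys b \<subseteq> B \<Longrightarrow> Poly_Mapping.keys (a - b) \<subseteq> B"
  using keys_diff[of a b] by blast

section \<open>The null subgroup of a tensor product of two fixed modules\<close>

context
  fixes R :: "('a, 'r) ring_scheme" and N :: "('a, 'n) module" and M :: "('a, 'm) module"
  assumes N: "right_module R N" and M: "left_module R M"
begin

interpretation N: right_module R N by (rule N)
interpretation M: left_module R M by (rule M)

lemma tensor_relators_carrier: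
  "tensor_relators R N M \<subseteq> carrier (free_Abelian_group (carrier N \<times> carrier M))"
proof -
  show ?thesis
    unfolding tensor_relators_def
    by (intro Un_least subsetI; elim CollectE exE conjE;
        simp add: keys_diff_subset N.rsmult_closed M.lsmult_closed N.M.a_closed M.M.a_closed)
qed

lemma tensor_null_subgroup:
  "subgroup (tensor_null R N M) (free_Abelian_group (carrier N \<times> carrier M))"
  unfolding tensor_null_def
  by (rule group.generate_is_subgroup[OF group_free_Abelian_group tensor_relators_carrier])

lemma tensor_null_coset:
  assumes "c \<in> tensor_null R N M"
  shows "tensor_null R N M #>\<^bsub>free_Abelian_group (carrier N \<times> carrier M)\<^esub> c = tensor_null R N M"
  using subgroup.rcos_const[OF tensor_null_subgroup group_free_Abelian_group assms] .

lemma tensor_null_induct [consumes 1, case_names zero relator minus add]: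
  assumes "c \<in> tensor_null R N M" and "P 0" and "\<And>c. c \<in> tensor_relators R N M \<Longrightarrow> P c"
    and "\<And>c. P c \<Longrightarrow> P (- c)" and "\<And>b c. P b \<Longrightarrow> P c \<Longrightarrow> P (b + c)"
  shows "P c"
  using assms(1) unfolding tensor_null_def
proof induction
  case (inv h)
  then have "h \<in> carrier (free_Abelian_group (carrier N \<times> carrier M))"
    using tensor_relators_carrier by blast
  then have "inv\<^bsub>free_Abelian_group (carrier N \<times> carrier M)\<^esub> h = - h"
    by (intro inv_free_Abelian_group) simp
  with inv assms show ?case by simp
qed (use assms in simp_all)

lemma tensor_null_add: "b \<in> tensor_null R N M \<Longrightarrow> c \<in> tensor_null R N M \<Longrightarrow> b + c \<in> tensor_null R N M"
  using subgroup.m_closed[OF tensor_null_subgroup] by simp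

lemma tensor_null_minus:
  assumes "c \<in> tensor_null R N M"
  shows "- c \<in> tensor_null R N M"
proof -
  have "c \<in> carrier (free_Abelian_group (carrier N \<times> carrier M))"
    using subgroup.mem_carrier[OF tensor_null_subgroup assms] .
  then have "inv\<^bsub>free_Abelian_group (carrier N \<times> carrier M)\<^esub> c = - c"
    by (intro inv_free_Abelian_group) simp
  then show ?thesis
    using subgroup.m_inv_closed[OF tensor_null_subgroup assms] by simp
qed

lemma tensor_null_diff: "b \<in> tensor_null R N M \<Longrightarrow> c \<in> tensor_null R N M \<Longrightarrow> b - c \<in> tensor_null R N M"
  using tensor_null_add[OF _ tensor_null_minus] by fastforce

lemma tensor_null_relator: "c \<in> tensor_relators R N M \<Longrightarrow> c \<in> tensor_null R N M"
  unfolding tensor_null_def by (rule generate.incl)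

lemma tensor_null_balance:
  assumes "a \<in> carrier R" "n \<in> carrier N" "m \<in> carrier M"
  shows "frag_of (a \<odot>\<^bsub>N\<^esub> n, m) \<in> tensor_null R N M \<longleftrightarrow> frag_of (n, a \<odot>\<^bsub>M\<^esub> m) \<in> tensor_null R N M"
proof -
  let ?b = "frag_of (a \<odot>\<^bsub>N\<^esub> n, m)" and ?c = "frag_of (n, a \<odot>\<^bsub>M\<^esub> m)"
  have "?b - ?c \<in> tensor_null R N M"
    by (rule tensor_null_relator) (use assms in \<open>unfold tensor_relators_def, blast\<close>)
  then show ?thesis
    using tensor_null_add[of "?b - ?c" ?c] tensor_null_diff[of ?b "?b - ?c"] by auto
qed

lemma tensor_null_zero_left:
  assumes "m \<in> carrier M"
  shows "frag_of (\<zero>\<^bsub>N\<^esub>, m) \<in> tensor_null R N M"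
proof -
  \<comment> \<open>As \<open>0 + 0 = 0\<close>, this relator is the negative of the required
    generator.\<close>
  have "frag_of (\<zero>\<^bsub>N\<^esub> \<oplus>\<^bsub>N\<^esub> \<zero>\<^bsub>N\<^esub>, m) - frag_of (\<zero>\<^bsub>N\<^esub>, m) - frag_of (\<zero>\<^bsub>N\<^esub>, m) \<in> tensor_null R N M"
    by (rule tensor_null_relator) (use assms N.M.zero_closed in \<open>unfold tensor_relators_def, blast\<close>)
  then show ?thesis
    using tensor_null_minus by fastforce
qed

text \<open>The additive extension of a balanced biadditive map kills all relators. A nonzero value
  of such a map thus shows that a tensor is nonzero.\<close>

lemma tensor_null_balanced:
  fixes b :: "'n \<times> 'm \<Rightarrow> 'v::ring_1"
  assumes "c \<in> tensor_null R N M"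
    and "\<And>n n' m. \<lbrakk>n \<in> carrier N; n' \<in> carrier N; m \<in> carrier M\<rbrakk> \<Longrightarrow> b (n \<oplus>\<^bsub>N\<^esub> n', m) = b (n, m) + b (n', m)"
    and "\<And>n m m'. \<lbrakk>n \<in> carrier N; m \<in> carrier M; m' \<in> carrier M\<rbrakk> \<Longrightarrow> b (n, m \<oplus>\<^bsub>M\<^esub> m') = b (n, m) + b (n, m')"
    and "\<And>a n m. \<lbrakk>a \<in> carrier R; n \<in> carrier N; m \<in> carrier M\<rbrakk> \<Longrightarrow> b (a \<odot>\<^bsub>N\<^esub> n, m) = b (n, a \<odot>\<^bsub>M\<^esub> m)"
  shows "lin_ext (\<lambda>i v. of_int i * v) b c = 0"
proof -
  let ?h = "lin_ext (\<lambda>i v. of_int i * v) b"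
  have add: "?h (x + y) = ?h x + ?h y" for x y
    by (rule lin_ext_add) (simp_all add: distrib_right)
  have zero: "?h 0 = 0"
    by (simp add: lin_ext_def)
  have minus: "?h (- x) = - ?h x" for x
    using add[of x "- x"] zero by (simp add: eq_neg_iff_add_eq_0 add.commute)
  have diff: "?h (x - y) = ?h x - ?h y" for x y
    using add[of x "- y"] minus by simp
  have of: "?h (frag_of z) = b z" for z
    by (simp add: lin_ext_single)
  show ?thesis
    using assms(1)
  proof (induction rule: tensor_null_induct)
    case (relator c)
    then show ?case
      unfolding tensor_relators_def by (auto simp: diff of assms(2-4))
  qed (simp_all add: zero minus add)
qed

end

text \<open>The induced map is well defined on the tensor product, because a module map carries
  relators to relators.\<close>

lemma tensor_null_map:
  assumes N: "right_module R N" and N': "right_module R N'" and M: "left_module R M"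
    and f: "f \<in> module_homs R N N'" and c: "c \<in> tensor_null R N M"
  shows "frag_extend (frag_of \<circ> (\<lambda>(n, m). (f n, m))) c \<in> tensor_null R N' M"
  using c
proof (induction rule: tensor_null_induct[OF N M, consumes 1, case_names zero relator minus add])
  case zero
  show ?case
    using subgroup.one_closed[OF tensor_null_subgroup[OF N' M]] by simp
next
  case (relator c)
  then have "frag_extend (frag_of \<circ> (\<lambda>(n, m). (f n, m))) c \<in> tensor_relators R N' M"
    using f unfolding tensor_relators_def module_homs_def
    by (auto simp: frag_extend_diff Pi_iff) blast+
  then show ?case
    by (rule tensor_null_relator[OF N' M])
qed (simp_all add: frag_extend_minus frag_extend_add tensor_null_minus[OF N' M] tensor_null_add[OF N' M])

text \<open>The class of \<open>(n, t)\<close> and the zero class are distinct but have the same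
  image; so injectivity is refuted by two membership questions about null subgroups.\<close>

lemma tensor_right_map_not_inj:
  assumes S: "ring S" and T: "ring T" and \<phi>: "\<phi> \<in> ring_hom S T"
    and L: "right_module S L" and M: "right_module S M" and f: "f \<in> module_homs S L M"
    and n: "n \<in> carrier L" and t: "t \<in> carrier T"
    and notnull: "frag_of (n, t) \<notin> tensor_null S L (left_via T \<phi>)"
    and null: "frag_of (f n, t) \<in> tensor_null S M (left_via T \<phi>)"
  shows "\<not> inj_on (tensor_right_map S T \<phi> M f) (carrier (tensor_right S T \<phi> L))"
proof
  let ?V = "left_via T \<phi>"
  let ?F = "free_Abelian_group (carrier L \<times> carrier ?V)" and ?K = "tensor_null S L ?V"
  let ?g = "tensor_right_map S T \<phi> M f"
  assume inj: "inj_on ?g (carrier (tensor_right S T \<phi> L))"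
  note V = left_module_left_via[OF S T \<phi>]
  note sub = tensor_null_subgroup[OF L V]
  have carrier: "?K #>\<^bsub>?F\<^esub> c \<in> carrier (tensor_right S T \<phi> L)" if "c \<in> carrier ?F" for c
    using that
    by (auto simp: tensor_right_def tensor_module_def tensor_group_def FactGroup_def RCOSETS_def)
  \<comment> \<open>All representatives of the coset land in the null subgroup, so the union
    defining \<open>tensor_map\<close> collapses to the zero class.\<close>
  have im: "?g (?K #>\<^bsub>?F\<^esub> c) = tensor_null S M ?V"
    if c: "frag_extend (frag_of \<circ> (\<lambda>(n, m). (f n, m))) c \<in> tensor_null S M ?V" for c
  proof -
    have "frag_extend (frag_of \<circ> (\<lambda>(n, m). (f n, m))) (k + c) \<in> tensor_null S M ?V" if "k \<in> ?K" for k
      using tensor_null_add[OF M V tensor_null_map[OF L M V f that] c] by (simp add: frag_extend_add)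
    moreover have "?K #>\<^bsub>?F\<^esub> c = (\<lambda>k. k + c) ` ?K"
      by (auto simp: r_coset_def)
    moreover have "?K \<noteq> {}"
      using subgroup.one_closed[OF sub] by blast
    ultimately show ?thesis
      unfolding tensor_right_map_def tensor_map_def
      by (simp del: left_via_simps add: tensor_null_coset[OF M V])
  qed
  have "?g (?K #>\<^bsub>?F\<^esub> frag_of (n, t)) = ?g (?K #>\<^bsub>?F\<^esub> 0)"
    using null subgroup.one_closed[OF tensor_null_subgroup[OF M V]] by (subst (1 2) im) simp_all
  then have "?K #>\<^bsub>?F\<^esub> frag_of (n, t) = ?K #>\<^bsub>?F\<^esub> 0"
    using n t by (intro inj_onD[OF inj] carrier) simp_all
  moreover have "?K #>\<^bsub>?F\<^esub> 0 = ?K"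
    using subgroup.one_closed[OF sub] by (intro tensor_null_coset[OF L V]) simp
  moreover have "frag_of (n, t) \<in> ?K #>\<^bsub>?F\<^esub> frag_of (n, t)"
    using n t by (intro group.rcos_self[OF group_free_Abelian_group _ sub]) simp
  ultimately show False
    using notnull by simp
qed


section \<open>The short exact sequence\<close>

text \<open>
  The modules must have their carriers in the type of sets of elements of \<open>A\<^sub>1\<close>, so a
  polynomial is encoded as the corresponding coset of \<open>x A\<^sub>1\<close>.
\<close>

definition poly_coset :: "'k::field poly \<Rightarrow> 'k weyl set" where
  "poly_coset P = {s \<in> carrier weyl_algebra. weyl_act s 1 = P}"

text \<open>The cosets are nonempty, and any element of one recovers the polynomial by acting on
  1.\<close>

lemma inj_poly_coset: "inj poly_coset"
proof (rule injI)
  fix P Q :: "'a poly"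
  assume eq: "poly_coset P = poly_coset Q"
  obtain s where "s \<in> poly_coset P"
    using weyl_act_transitive[of P] by (auto simp: poly_coset_def)
  with eq have "s \<in> poly_coset P" "s \<in> poly_coset Q" by simp_all
  then show "P = Q" by (simp add: poly_coset_def)
qed

definition coset_poly :: "'k::field weyl set \<Rightarrow> 'k poly" where
  "coset_poly = the_inv poly_coset"

lemma coset_poly_poly_coset [simp]: "coset_poly (poly_coset P) = P"
  by (simp add: coset_poly_def the_inv_f_f inj_poly_coset)

lemma poly_coset_eq_iff [simp]: "poly_coset P = poly_coset Q \<longleftrightarrow> P = Q"
  using inj_poly_coset by (auto dest: injD)

text \<open>The quotient of \<open>k[t]\<close> by the kernel of an idempotent \<open>r\<close>, on the range of \<open>r\<close>.\<close>

definition poly_module :: "('k::field poly \<Rightarrow> 'k poly) \<Rightarrow> ('k weyl, 'k weyl set) module" where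
  "poly_module r =
     \<lparr>carrier = poly_coset ` range r, monoid.mult = undefined, one = undefined,
      ring.zero = poly_coset 0, add = (\<lambda>a b. poly_coset (coset_poly a + coset_poly b)),
      module.smult = (\<lambda>s a. poly_coset (r (weyl_act s (coset_poly a))))\<rparr>"

lemma poly_module_simps [simp]:
  "carrier (poly_module r) = poly_coset ` range r"
  "\<zero>\<^bsub>poly_module r\<^esub> = poly_coset 0"
  "poly_coset P \<oplus>\<^bsub>poly_module r\<^esub> poly_coset Q = poly_coset (P + Q)"
  "s \<odot>\<^bsub>poly_module r\<^esub> poly_coset P = poly_coset (r (weyl_act s P))"
  by (simp_all add: poly_module_def)

text \<open>Given additivity and idempotence, the condition \<open>act\<close> says that the kernel
  of \<open>r\<close> is a submodule.\<close>

lemma right_module_poly_module: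
  assumes add: "\<And>P Q. r (P + Q) = r P + r Q" and idem: "\<And>P. r (r P) = r P"
    and act: "\<And>s P. r (weyl_act s (r P)) = r (weyl_act s P)"
  shows "right_module weyl_algebra (poly_module r)"
proof -
  have range_add: "r P + r Q \<in> range r" for P Q
    by (simp flip: add)
  have zero: "r 0 = 0"
    using add[of 0 0] by (metis add.right_neutral add_left_cancel)
  have "abelian_group (poly_module r)"
  proof (rule abelian_groupI)
    fix a assume "a \<in> carrier (poly_module r)"
    then obtain P where a: "a = poly_coset (r P)" by auto
    have "r (- P) + r P = 0"
      using zero by (simp flip: add)
    then show "\<exists>b\<in>carrier (poly_module r). b \<oplus>\<^bsub>poly_module r\<^esub> a = \<zero>\<^bsub>poly_module r\<^esub>"
      by (intro bexI[of _ "poly_coset (r (- P))"]) (auto simp: a)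
  next
    have "poly_coset (r 0) \<in> carrier (poly_module r)" by simp
    then show "\<zero>\<^bsub>poly_module r\<^esub> \<in> carrier (poly_module r)"
      by (simp only: zero poly_module_simps)
  qed (auto simp: algebra_simps range_add)
  \<comment> \<open>A normal form for associativity: every \<open>r\<close> inside the outermost one
    is removed.\<close>
  moreover have "r (weyl_act b (weyl_act a (r P))) = r (weyl_act b (weyl_act a P))" for a b P
    by (metis act)
  ultimately show ?thesis
    by (intro right_module.intro right_module_axioms.intro weyl_ring)
      (auto simp: weyl_act_add weyl_act_mult weyl_act_one weyl_act_add_right add idem act)
qed

lemma right_module_poly_module_id: "right_module weyl_algebra (poly_module (\<lambda>P. P))"
  by (rule right_module_poly_module) simp_all

lemma right_module_poly_module_cutoff:
  "right_module weyl_algebra (poly_module (poly_cutoff CHAR('k) :: 'k::field poly \<Rightarrow> 'k poly))"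
  by (rule right_module_poly_module)
    (simp_all add: poly_cutoff_add weyl_act_def poly_cutoff_poly_act_cutoff)

lemma module_homs_poly_module:
  assumes "\<And>P. h (r P) \<in> range r'" and "\<And>P Q. h (P + Q) = h P + h Q"
    and "\<And>s P. h (r (weyl_act s (r P))) = r' (weyl_act s (h (r P)))"
  shows "(\<lambda>a. poly_coset (h (coset_poly a))) \<in> module_homs weyl_algebra (poly_module r) (poly_module r')"
  using assms by (auto simp: module_homs_def)

text \<open>The sequence \<open>V \<rightarrow> V \<rightarrow> V / t\<^sup>p V\<close>, with the
  quotient realized by truncated polynomials.\<close>

lemma short_exact_monom_CHAR:
  fixes f g :: "'k::field weyl set \<Rightarrow> 'k weyl set"
  defines "f \<equiv> (\<lambda>a. poly_coset (monom 1 CHAR('k) * coset_poly a))"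
    and "g \<equiv> (\<lambda>a. poly_coset (poly_cutoff CHAR('k) (coset_poly a)))"
  shows "f \<in> module_homs weyl_algebra (poly_module (\<lambda>P. P)) (poly_module (\<lambda>P. P))"
    and "g \<in> module_homs weyl_algebra (poly_module (\<lambda>P. P)) (poly_module (poly_cutoff CHAR('k)))"
    and "short_exact (poly_module (\<lambda>P. P)) (poly_module (\<lambda>P. P)) (poly_module (poly_cutoff CHAR('k))) f g"
proof -
  show "f \<in> module_homs weyl_algebra (poly_module (\<lambda>P. P)) (poly_module (\<lambda>P. P))"
    unfolding f_def
    by (rule module_homs_poly_module) (simp_all add: distrib_left weyl_act_def poly_act_monom_CHAR)
  show "g \<in> module_homs weyl_algebra (poly_module (\<lambda>P. P)) (poly_module (poly_cutoff CHAR('k)))"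
    unfolding g_def
    by (rule module_homs_poly_module)
      (simp_all add: poly_cutoff_add weyl_act_def poly_cutoff_poly_act_cutoff)
  have "inj_on f (carrier (poly_module (\<lambda>P. P)))"
    by (auto simp: f_def inj_on_def)
  moreover have "f ` carrier (poly_module (\<lambda>P. P)) =
      a_kernel (poly_module (\<lambda>P. P)) (poly_module (poly_cutoff CHAR('k))) g"
    by (auto simp: a_kernel_def' f_def g_def poly_cutoff_eq_0_iff image_iff)
  moreover have "g ` carrier (poly_module (\<lambda>P. P)) = carrier (poly_module (poly_cutoff CHAR('k)))"
    by (simp add: g_def image_image)
  ultimately show "short_exact (poly_module (\<lambda>P. P)) (poly_module (\<lambda>P. P))
      (poly_module (poly_cutoff CHAR('k))) f g"
    by (simp add: short_exact_def)
qed

section \<open>Failure of left flatness\<close>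

lemma is_phi_d_power_CHAR:
  fixes \<phi> :: "'k::field weyl \<Rightarrow> 'k weyl"
  assumes \<phi>: "is_phi CHAR('k) \<phi>" and p: "CHAR('k) > 0"
  obtains c where "\<phi> (weyl_class (free_gen Gen_d ^ CHAR('k))) =
    \<phi> weyl_x \<otimes>\<^bsub>weyl_algebra\<^esub> weyl_class c"
proof -
  note hom = is_phi_props(1)[OF \<phi>]
  have power: "\<phi> (weyl_class (f ^ n)) = \<phi> (weyl_class f) [^]\<^bsub>weyl_algebra\<^esub> n" for f n
    by (induction n)
      (simp_all add: weyl_class_one weyl_class_mult ring_hom_one[OF hom] ring_hom_mult[OF hom]
        power_Suc2 del: power_Suc)
  obtain c where "phi_gen CHAR('k) Gen_d ^ CHAR('k) - free_gen Gen_x * c \<in> (weyl_ideal :: 'k free_alg set)"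
    using phi_gen_d_power_CHAR[OF p] unfolding x_multiples_def by blast
  then have "weyl_class (phi_gen CHAR('k) Gen_d ^ CHAR('k)) = weyl_class (free_gen Gen_x * c)"
    by (simp only: weyl_class_eq_iff)
  \<comment> \<open>The left factor \<open>x\<close> is written as \<open>\<phi> weyl_x\<close>, so
    that balancing can move it across the tensor sign.\<close>
  then have "\<phi> (weyl_class (free_gen Gen_d ^ CHAR('k))) = \<phi> weyl_x \<otimes>\<^bsub>weyl_algebra\<^esub> weyl_class c"
    by (simp only: power is_phi_props(3)[OF \<phi>] weyl_class_power[symmetric] weyl_x_def
        phi_gen_simps(1) weyl_class_mult)
  then show ?thesis by (rule that)
qed

lemma is_phi_not_left_flat:
  fixes \<phi> :: "'k::field weyl \<Rightarrow> 'k weyl"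
  assumes \<phi>: "is_phi CHAR('k) \<phi>" and p: "CHAR('k) > 0"
  shows "\<not> left_flat TYPE('k weyl set) weyl_algebra weyl_algebra \<phi>"
proof
  let ?A = "weyl_algebra :: 'k weyl ring"
  let ?V = "poly_module (\<lambda>P :: 'k poly. P)" and ?T = "left_via ?A \<phi>"
  let ?c = "poly_cutoff CHAR('k) :: 'k poly \<Rightarrow> 'k poly"
  define f :: "'k weyl set \<Rightarrow> 'k weyl set"
    where "f = (\<lambda>a. poly_coset (monom 1 CHAR('k) * coset_poly a))"
  define g :: "'k weyl set \<Rightarrow> 'k weyl set"
    where "g = (\<lambda>a. poly_coset (?c (coset_poly a)))"
  note hom = is_phi_props(1)[OF \<phi>]
  note V = right_module_poly_module_id
  note T = left_module_left_via[OF weyl_ring weyl_ring hom]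
  have f: "f \<in> module_homs ?A ?V ?V"
    using short_exact_monom_CHAR(1) unfolding f_def .
  interpret A: ring ?A by (rule weyl_ring)

  have "frag_of (f (poly_coset 1), \<one>\<^bsub>?A\<^esub>) \<in> tensor_null ?A ?V ?T"
  proof -
    obtain c where c: "\<phi> (weyl_class (free_gen Gen_d ^ CHAR('k))) = \<phi> weyl_x \<otimes>\<^bsub>?A\<^esub> weyl_class c"
      using is_phi_d_power_CHAR[OF assms] .
    have x: "weyl_x \<odot>\<^bsub>?V\<^esub> poly_coset 1 = \<zero>\<^bsub>?V\<^esub>"
      by (simp add: weyl_x_def weyl_act_class)
    \<comment> \<open>The chain of equal tensors is followed backwards from
      \<open>1 . x \<otimes> c = 0\<close>, balancing first along \<open>x\<close> and then along
      \<open>\<partial>\<^sup>p\<close>.\<close>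
    have "frag_of (weyl_x \<odot>\<^bsub>?V\<^esub> poly_coset 1, weyl_class c) \<in> tensor_null ?A ?V ?T"
      unfolding x by (rule tensor_null_zero_left[OF V T]) simp
    then have "frag_of (poly_coset 1, \<phi> weyl_x \<otimes>\<^bsub>?A\<^esub> weyl_class c) \<in> tensor_null ?A ?V ?T"
      by (subst (asm) tensor_null_balance[OF V T]) (simp_all add: weyl_x_def)
    then have "frag_of (weyl_class (free_gen Gen_d ^ CHAR('k)) \<odot>\<^bsub>?V\<^esub> poly_coset 1, \<one>\<^bsub>?A\<^esub>)
        \<in> tensor_null ?A ?V ?T"
      using ring_hom_closed[OF hom weyl_class_closed]
      by (subst tensor_null_balance[OF V T]) (simp_all flip: c)
    then show ?thesis
      by (simp add: f_def weyl_act_class poly_act_power funpow_pCons)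
  qed
  moreover have "frag_of (poly_coset 1, \<one>\<^bsub>?A\<^esub>) \<notin> tensor_null ?A ?V ?T"
  proof
    \<comment> \<open>Truncate the polynomial, then act by the second component.\<close>
    define b :: "'k weyl set \<times> 'k weyl \<Rightarrow> 'k poly"
      where "b = (\<lambda>(n, t). weyl_act t (?c (coset_poly n)))"
    assume "frag_of (poly_coset 1, \<one>\<^bsub>?A\<^esub>) \<in> tensor_null ?A ?V ?T"
    then have "lin_ext (\<lambda>i v. of_int i * v) b (frag_of (poly_coset 1, \<one>\<^bsub>?A\<^esub>)) = 0"
      by (rule tensor_null_balanced[OF V T])
        (auto simp: b_def poly_cutoff_add weyl_act_add_right weyl_act_add weyl_act_mult
          ring_hom_closed[OF hom] weyl_act_is_phi_cutoff[OF assms])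
    then have "?c 1 = 0"
      by (simp add: lin_ext_single b_def weyl_act_one)
    \<comment> \<open>Truncation keeps the constant coefficient 1 because
      \<open>CHAR('k) > 0\<close>.\<close>
    then have "coeff (?c 1) 0 = 0" by simp
    with p show False
      by (simp add: coeff_poly_cutoff)
  qed
  ultimately have "\<not> inj_on (tensor_right_map ?A ?A \<phi> ?V f) (carrier (tensor_right ?A ?A \<phi> ?V))"
    by (intro tensor_right_map_not_inj[OF weyl_ring weyl_ring hom V V f, of "poly_coset 1" "\<one>\<^bsub>?A\<^esub>"])
      simp_all
  moreover assume flat: "left_flat TYPE('k weyl set) ?A ?A \<phi>"
  have "short_exact (tensor_right ?A ?A \<phi> ?V) (tensor_right ?A ?A \<phi> ?V) (tensor_right ?A ?A \<phi> (poly_module ?c))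
      (tensor_right_map ?A ?A \<phi> ?V f) (tensor_right_map ?A ?A \<phi> (poly_module ?c) g)"
    by (rule flat[unfolded left_flat_def, rule_format])
      (intro conjI V right_module_poly_module_cutoff f;
        simp only: f_def g_def short_exact_monom_CHAR)
  ultimately show False
    by (simp add: short_exact_def)
qed

theorem mainTheorem3:
  fixes p :: nat
  assumes "CHAR('k::field) = p" and "p > 0"
  shows "(\<exists>\<phi> :: 'k weyl \<Rightarrow> 'k weyl. is_phi p \<phi>) \<and>
    (\<forall>\<phi> :: 'k weyl \<Rightarrow> 'k weyl. is_phi p \<phi> \<longrightarrow>
       \<not> flat_hom TYPE('k weyl set) weyl_algebra weyl_algebra \<phi>)"
  using assms is_phi_exists[where 'k = 'k] is_phi_not_left_flat[where 'k = 'k]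
  by (auto simp: flat_hom_def)

end
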